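(* Let $n$ be an even positive integer and let $a,b,c:\mathbb{Z}_2^n\to\mathbb{Z}_2$ be Boolean functions such that $a$, $b$, $c$, $a\oplus c$, $b\oplus c$ and $a\oplus b$ are all bent and $$W_a(\mathbf{x})W_b(\mathbf{x})+W_{a\oplus c}(\mathbf{x})W_{b\oplus c}(\mathbf{x})=-2\,W_{a\oplus b}(\mathbf{x})W_c(\mathbf{x})\quad\text{for all }\mathbf{x}\in\mathbb{Z}_2^n.$$ Let $f:\mathbb{Z}_2^{n+2}\to\mathbb{Z}_8$ be given, for $\mathbf{x}\in\mathbb{Z}_2^n$ and $y,z\in\mathbb{Z}_2$, by $$f(\mathbf{x},y,z)=4c(\mathbf{x})+(4a(\mathbf{x})+2c(\mathbf{x})+1)\,y+(4b(\mathbf{x})+2c(\mathbf{x})+1)\,z-2yz.$$ Then $f$ is gbent (as a function from $\mathbb{Z}_2^{n+2}$ to $\mathbb{Z}_8$).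
   Context: A Boolean function on $n$ variables is a function $\mathbb{Z}_2^n\to\mathbb{Z}_2$; $\oplus$ denotes addition modulo $2$, and $\mathbf{u}\cdot\mathbf{x}=u_nx_n\oplus\cdots\oplus u_1x_1$. In the formula for $f$, the bits $a(\mathbf{x}),b(\mathbf{x}),c(\mathbf{x}),y,z$ are regarded as the integers $0,1$ and the arithmetic is modulo $8$. The normalized Walsh--Hadamard transform of a Boolean function $g$ on $n$ variables is $W_g(\mathbf{u})=2^{-n/2}\sum_{\mathbf{x}\in\mathbb{Z}_2^n}(-1)^{g(\mathbf{x})}(-1)^{\mathbf{u}\cdot\mathbf{x}}$; for $n$ even, $g$ is bent if $|W_g(\mathbf{u})|=1$ for all $\mathbf{u}$. With $\zeta=e^{2\pi\imath/8}$, the generalized Walsh--Hadamard transform of $f:\mathbb{Z}_2^m\to\mathbb{Z}_8$ is $\mathcal{H}_f(\mathbf{u})=2^{-m/2}\sum_{\mathbf{x}\in\mathbb{Z}_2^m}\zeta^{f(\mathbf{x})}(-1)^{\mathbf{u}\cdot\mathbf{x}}$, and $f$ is gbent (generalized bent) if $|\mathcal{H}_f(\mathbf{u})|=1$ for all $\mathbf{u}\in\mathbb{Z}_2^m$. *)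

theory Defs
  imports "HOL-Analysis.Analysis" "HOL-Library.Z2" "HOL-Library.Numeral_Type"
begin

text \<open>
  Since dimensions \<open>n\<close> and \<open>n + 2\<close> occur together, vectors over \<open>\<int>\<^sub>2\<close> are lists of bits of
  a given length. A function on \<open>\<int>\<^sub>2\<^sup>n\<close> is a function on lists that is only ever
  evaluated on lists of length \<open>n\<close>. The codomain \<open>\<int>\<^sub>8\<close> is the ring type \<^typ>\<open>8\<close>.
\<close>

definition bitvecs :: "nat \<Rightarrow> bit list set" where
  "bitvecs n = {x. length x = n}"

definition bdot :: "bit list \<Rightarrow> bit list \<Rightarrow> bit" where
  "bdot u x = (\<Sum>i<length x. u ! i * x ! i)"

definition bit_sign :: "bit \<Rightarrow> 'a::ring_1" where
  "bit_sign b = (- 1) ^ (of_bit b :: nat)"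

definition walsh :: "nat \<Rightarrow> (bit list \<Rightarrow> bit) \<Rightarrow> bit list \<Rightarrow> real" where
  "walsh n g u =
     2 powr (- (real n / 2)) * (\<Sum>x\<in>bitvecs n. bit_sign (g x) * bit_sign (bdot u x))"

definition bent :: "nat \<Rightarrow> (bit list \<Rightarrow> bit) \<Rightarrow> bool" where
  "bent n g \<longleftrightarrow> even n \<and> (\<forall>u\<in>bitvecs n. \<bar>walsh n g u\<bar> = 1)"

definition zeta8 :: complex where
  "zeta8 = exp (2 * of_real pi * \<i> / 8)"

text \<open>
  The power \<open>\<zeta>\<^sup>k\<close> for \<open>k \<in> \<int>\<^sub>8\<close> is formed with the representative of \<open>k\<close> in \<open>{0..<8}\<close>;
  the lemma below shows that every other integer representative gives the same value.
\<close>

definition zeta8_pow :: "8 \<Rightarrow> complex" where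
  "zeta8_pow k = zeta8 ^ nat (Rep_bit0 k)"

lemma zeta8_pow_of_int: "zeta8_pow (of_int k) = zeta8 powi k"
proof -
  have z8: "zeta8 ^ 8 = 1"
    using exp_two_pi_i' by (simp add: zeta8_def mult_ac flip: exp_of_nat_mult)
  have nz: "zeta8 \<noteq> 0"
    by (simp add: zeta8_def)
  have rep: "Rep_bit0 (of_int k :: 8) = k mod 8"
    using bit0.of_int_eq[where 'a = 4, of k]
    by (simp add: Abs_bit0_inverse)
  have "zeta8 powi k = zeta8 powi (8 * (k div 8) + k mod 8)"
    by simp
  also have "\<dots> = (zeta8 powi 8) powi (k div 8) * zeta8 powi (k mod 8)"
    using nz by (simp only: power_int_add power_int_mult simp_thms)
  also have "zeta8 powi 8 = 1"
    using z8 by simp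
  also have "1 powi (k div 8) * zeta8 powi (k mod 8) = zeta8 ^ nat (k mod 8)"
    by (simp add: power_int_def)
  finally show ?thesis
    by (simp add: zeta8_pow_def rep)
qed

definition gen_walsh :: "nat \<Rightarrow> (bit list \<Rightarrow> 8) \<Rightarrow> bit list \<Rightarrow> complex" where
  "gen_walsh m f u =
     of_real (2 powr (- (real m / 2))) *
       (\<Sum>x\<in>bitvecs m. zeta8_pow (f x) * bit_sign (bdot u x))"

definition gbent :: "nat \<Rightarrow> (bit list \<Rightarrow> 8) \<Rightarrow> bool" where
  "gbent m f \<longleftrightarrow> (\<forall>u\<in>bitvecs m. cmod (gen_walsh m f u) = 1)"

end

theory Submission
  imports Defs
begin

text \<open>
  Fix \<open>x\<close>. The four values \<open>f (x, y, z)\<close> are \<open>4c\<close>, \<open>4(a + c) + 2c + 1\<close>, \<open>4(b + c) + 2c + 1\<close>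
  and \<open>4(a + b)\<close> modulo \<open>8\<close>, so \<open>\<zeta>\<^sup>f\<close> takes there the values
  \<open>(-1)\<^sup>c\<close>, \<open>\<zeta> \<i>\<^sup>c (-1)\<^bsup>a+c\<^esup>\<close>, \<open>\<zeta> \<i>\<^sup>c (-1)\<^bsup>b+c\<^esup>\<close> and \<open>(-1)\<^bsup>a+b\<^esup>\<close>.
  The factor \<open>\<zeta> \<i>\<^sup>c\<close> is itself a combination \<open>(\<i> + (-1)\<^sup>c) / \<surd>2\<close> of signs, so that the
  generalized transform of \<open>f\<close> becomes a combination of ordinary Walsh transforms: writing
  \<open>A, B, C, D, E, F\<close> for the transforms of \<open>a\<close>, \<open>b\<close>, \<open>c\<close>, \<open>a + b\<close>, \<open>a + c\<close>, \<open>b + c\<close> at \<open>w\<close>,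
  and \<open>\<sigma> = (-1)\<^sup>s\<close>, \<open>\<tau> = (-1)\<^sup>t\<close>,
  \<open>2 \<H>\<^sub>f (w, s, t) = C + \<sigma> (A + \<i> E) / \<surd>2 + \<tau> (B + \<i> F) / \<surd>2 + \<sigma> \<tau> D\<close>
  (lemma \<open>gen_walsh_decomposition\<close>).

  All of \<open>A, \<dots>, F\<close> are \<open>\<plusminus>1\<close>, hence the squared modulus of the right-hand side is
  \<open>4 + \<sigma> \<tau> (2 C D + A B + E F) + \<surd>2 (C + \<sigma> \<tau> D) (\<sigma> A + \<tau> B)\<close>. The hypothesis says precisely
  that the second term vanishes. Moreover \<open>A B\<close> and \<open>E F\<close> are signs whose sum is \<open>\<plusminus>2\<close>, so both
  equal \<open>- C D\<close>; therefore one of the two factors of the third term is zero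
  (lemma \<open>cmod_sign_combination\<close>).
\<close>

section \<open>Signs and eighth roots of unity\<close>

lemma bit_sign_0 [simp]: "bit_sign 0 = 1" and bit_sign_1 [simp]: "bit_sign 1 = - 1"
  by (simp_all add: bit_sign_def)

lemma bit_sign_add: "bit_sign (p + q) = bit_sign p * bit_sign q"
  by (cases p; cases q) simp_all

lemma bit_sign_square: "bit_sign p * bit_sign p = 1"
  by (cases p) simp_all

lemma of_real_bit_sign: "of_real (bit_sign p) = bit_sign p"
  by (cases p) simp_all

lemma abs_bit_sign: "\<bar>bit_sign p\<bar> = (1 :: real)"
  by (cases p) simp_all

lemma zeta8_eq: "zeta8 = (1 + \<i>) / of_real (sqrt 2)"
proof -
  have "zeta8 = cis (pi / 4)"
    by (simp add: zeta8_def cis_conv_exp mult_ac)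
  also have "\<dots> = (1 + \<i>) / of_real (sqrt 2)"
    by (simp add: complex_eq_iff cos_45 sin_45 real_div_sqrt field_simps)
  finally show ?thesis .
qed

lemma zeta8_square: "zeta8 ^ 2 = \<i>"
proof -
  have "(of_real (sqrt 2) :: complex) ^ 2 = 2"
    by (simp flip: of_real_power)
  then show ?thesis
    by (simp add: zeta8_eq power_divide power2_eq_square algebra_simps)
qed

lemma zeta8_pow_add: "zeta8_pow (j + k) = zeta8_pow j * zeta8_pow k"
proof -
  obtain p q where "j = of_int p" "k = of_int q"
    by (metis bit0_cases)
  moreover have "zeta8 \<noteq> 0"
    by (simp add: zeta8_def)
  ultimately show ?thesis
    by (simp add: zeta8_pow_of_int power_int_add flip: of_int_add)
qed

lemma zeta8_pow_0: "zeta8_pow 0 = 1"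
  using zeta8_pow_of_int[of 0] by simp

lemma zeta8_pow_1: "zeta8_pow 1 = zeta8"
  using zeta8_pow_of_int[of 1] by simp

lemma zeta8_pow_2: "zeta8_pow 2 = \<i>"
  using zeta8_pow_of_int[of 2] by (simp add: zeta8_square)

lemma zeta8_pow_4: "zeta8_pow 4 = - 1"
  using zeta8_pow_add[of 2 2] by (simp add: zeta8_pow_2)

lemma zeta8_pow_4_of_bit: "zeta8_pow (4 * of_bit p) = bit_sign p"
  by (cases p) (simp_all add: zeta8_pow_0 zeta8_pow_4)

text \<open>
  The two values \<open>\<zeta>\<close> and \<open>\<zeta> \<i>\<close> have equal imaginary parts and opposite real parts, so a power of
  \<open>\<i>\<close> with exponent a bit can be traded for a sign; this is what makes ordinary Walsh
  transforms appear.
\<close>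

lemma zeta8_pow_2_of_bit_add_1:
  "zeta8_pow (2 * of_bit p + 1) = (\<i> + bit_sign p) / of_real (sqrt 2)"
  unfolding zeta8_pow_add zeta8_pow_1 zeta8_eq
  by (cases p) (simp_all add: zeta8_pow_0 zeta8_pow_2 algebra_simps)

section \<open>Splitting off the last two coordinates\<close>

lemma finite_bitvecs: "finite (bitvecs n)"
proof -
  have "finite (UNIV :: bit set)"
    using bit.exhaust by (intro finite_subset[of UNIV "{0, 1}"]) auto
  then show ?thesis
    using finite_lists_length_eq[of "UNIV :: bit set" n] by (simp add: bitvecs_def)
qed

lemma sum_UNIV_bit: "(\<Sum>y\<in>UNIV. g (y :: bit)) = g 0 + g 1"
proof -
  have "(UNIV :: bit set) = {0, 1}"
    using bit.exhaust by auto
  then have "(\<Sum>y\<in>UNIV. g y) = (\<Sum>y\<in>{0, 1}. g y)"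
    by (rule arg_cong)
  also have "\<dots> = g 0 + g 1"
    by (subst sum.insert) simp_all
  finally show ?thesis .
qed

lemma sum_bitvecs_add_2:
  "(\<Sum>x\<in>bitvecs (n + 2). g x) =
     (\<Sum>x\<in>bitvecs n. g (x @ [0, 0]) + g (x @ [1, 0]) + g (x @ [0, 1]) + g (x @ [1, 1]))"
proof -
  have "bij_betw (\<lambda>(x, y, z). x @ [y, z]) (bitvecs n \<times> UNIV \<times> UNIV) (bitvecs (n + 2))"
    by (rule bij_betw_byWitness
          [where f' = "\<lambda>v. (take n v, v ! n, v ! Suc n)"])
      (auto simp: bitvecs_def nth_append less_Suc_eq intro!: nth_equalityI)
  from sum.reindex_bij_betw[OF this, of g]
  have "(\<Sum>x\<in>bitvecs (n + 2). g x) = (\<Sum>x\<in>bitvecs n. \<Sum>y\<in>UNIV. \<Sum>z\<in>UNIV. g (x @ [y, z]))"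
    by (simp add: sum.cartesian_product split_def)
  then show ?thesis
    by (simp add: sum_UNIV_bit add_ac)
qed

lemma bitvecs_add_2_cases:
  assumes "u \<in> bitvecs (n + 2)"
  obtains w s t where "u = w @ [s, t]" and "w \<in> bitvecs n"
proof -
  have "length (drop n u) = Suc (Suc 0)"
    using assms by (simp add: bitvecs_def)
  then obtain s t where "drop n u = [s, t]"
    unfolding length_Suc_conv length_0_conv by blast
  then show thesis
    using that[of "take n u" s t] assms append_take_drop_id[of n u] by (auto simp: bitvecs_def)
qed

lemma bdot_append:
  assumes "length w = length x"
  shows "bdot (w @ [s, t]) (x @ [y, z]) = bdot w x + s * y + t * z"
  using assms by (simp add: bdot_def nth_append)

section \<open>The generalized transform in terms of Walsh transforms\<close>

lemma of_real_walsh: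
  "of_real (walsh n g u) =
     of_real (2 powr (- (real n / 2))) *
       (\<Sum>x\<in>bitvecs n. bit_sign (g x) * (bit_sign (bdot u x) :: complex))"
  by (simp add: walsh_def of_real_bit_sign)

lemma gen_walsh_decomposition:
  fixes a b c :: "bit list \<Rightarrow> bit" and f :: "bit list \<Rightarrow> 8"
  assumes f: "\<And>x y z. x \<in> bitvecs n \<Longrightarrow>
      f (x @ [y, z]) =
        4 * of_bit (c x)
        + (4 * of_bit (a x) + 2 * of_bit (c x) + 1) * of_bit y
        + (4 * of_bit (b x) + 2 * of_bit (c x) + 1) * of_bit z
        - 2 * of_bit y * of_bit z"
    and w: "w \<in> bitvecs n"
  shows "2 * gen_walsh (n + 2) f (w @ [s, t]) =
    of_real (walsh n c w)
    + of_real (bit_sign s)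
      * (of_real (walsh n a w) + \<i> * of_real (walsh n (\<lambda>x. a x + c x) w)) / of_real (sqrt 2)
    + of_real (bit_sign t)
      * (of_real (walsh n b w) + \<i> * of_real (walsh n (\<lambda>x. b x + c x) w)) / of_real (sqrt 2)
    + of_real (bit_sign s) * of_real (bit_sign t) * of_real (walsh n (\<lambda>x. a x + b x) w)"
proof -
  define \<rho> :: complex where "\<rho> = 1 / of_real (sqrt 2)"
  define \<sigma> \<tau> :: complex where "\<sigma> = of_real (bit_sign s)" and "\<tau> = of_real (bit_sign t)"
  define A B C e :: "bit list \<Rightarrow> complex"
    where "A = (\<lambda>x. bit_sign (a x))" and "B = (\<lambda>x. bit_sign (b x))"
      and "C = (\<lambda>x. bit_sign (c x))" and "e = (\<lambda>x. bit_sign (bdot w x))"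
  let ?g = "\<lambda>v. zeta8_pow (f v) * bit_sign (bdot (w @ [s, t]) v)"
  have summand: "?g (x @ [0, 0]) + ?g (x @ [1, 0]) + ?g (x @ [0, 1]) + ?g (x @ [1, 1]) =
      C x * e x + \<sigma> * \<rho> * (A x * e x + \<i> * (A x * C x * e x))
      + \<tau> * \<rho> * (B x * e x + \<i> * (B x * C x * e x)) + \<sigma> * \<tau> * (A x * B x * e x)"
    if x: "x \<in> bitvecs n" for x
  proof -
    have len: "length w = length x"
      using w x by (simp add: bitvecs_def)
    have CC: "C x * C x = 1"
      by (simp add: C_def bit_sign_square)
    have sum4: "zeta8_pow (4 * of_bit (c x)) = C x" "zeta8_pow (4 * of_bit (a x)) = A x"
      "zeta8_pow (4 * of_bit (b x)) = B x"
      unfolding A_def B_def C_def by (rule zeta8_pow_4_of_bit)+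
    have f00: "zeta8_pow (f (x @ [0, 0])) = C x"
    proof -
      have "f (x @ [0, 0]) = 4 * of_bit (c x)"
        using x by (simp add: f)
      then show ?thesis
        by (simp only: sum4)
    qed
    have f10: "zeta8_pow (f (x @ [1, 0])) = C x * A x * (\<i> + C x) * \<rho>"
    proof -
      have "f (x @ [1, 0]) = 4 * of_bit (c x) + 4 * of_bit (a x) + (2 * of_bit (c x) + 1)"
        using x by (simp add: f)
      then show ?thesis
        by (simp only: zeta8_pow_add[of "_ + _" "_ + 1"] zeta8_pow_add[of "4 * _"]
            zeta8_pow_2_of_bit_add_1 sum4) (simp add: \<rho>_def C_def)
    qed
    have f01: "zeta8_pow (f (x @ [0, 1])) = C x * B x * (\<i> + C x) * \<rho>"
    proof -
      have "f (x @ [0, 1]) = 4 * of_bit (c x) + 4 * of_bit (b x) + (2 * of_bit (c x) + 1)"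
        using x by (simp add: f)
      then show ?thesis
        by (simp only: zeta8_pow_add[of "_ + _" "_ + 1"] zeta8_pow_add[of "4 * _"]
            zeta8_pow_2_of_bit_add_1 sum4) (simp add: \<rho>_def C_def)
    qed
    have f11: "zeta8_pow (f (x @ [1, 1])) = A x * B x"
    proof -
      \<comment> \<open>The two copies of \<open>4c\<close> are kept, since their signs cancel without reduction modulo \<open>8\<close>.\<close>
      have "f (x @ [1, 1]) =
          4 * of_bit (c x) + (4 * of_bit (c x) + (4 * of_bit (a x) + 4 * of_bit (b x)))"
        using x by (simp add: f)
      then show ?thesis
        using CC by (simp only: zeta8_pow_add sum4) (simp flip: mult.assoc)
    qed
    have characters: "bit_sign (bdot (w @ [s, t]) (x @ [0, 0])) = e x"
      "bit_sign (bdot (w @ [s, t]) (x @ [1, 0])) = \<sigma> * e x"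
      "bit_sign (bdot (w @ [s, t]) (x @ [0, 1])) = \<tau> * e x"
      "bit_sign (bdot (w @ [s, t]) (x @ [1, 1])) = \<sigma> * \<tau> * e x"
      unfolding bdot_append[OF len] bit_sign_add of_real_bit_sign \<sigma>_def \<tau>_def e_def
      by (simp_all add: mult_ac)
    have "C x * A x * (\<i> + C x) * \<rho> = \<rho> * (A x + \<i> * (A x * C x))"
      "C x * B x * (\<i> + C x) * \<rho> = \<rho> * (B x + \<i> * (B x * C x))"
      using CC by algebra+
    then show ?thesis
      unfolding f00 f10 f01 f11 characters by (simp only:) (simp add: algebra_simps)
  qed
  define N :: complex where "N = of_real (2 powr (- (real n / 2)))"
  have "2 * 2 powr (- (real (n + 2) / 2)) = 2 powr (- (real n / 2))"
    by (simp add: add_divide_distrib powr_diff powr_minus_divide)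
  then have N: "2 * of_real (2 powr (- (real (n + 2) / 2))) = N"
    unfolding N_def by (metis of_real_mult of_real_numeral)
  have walsh:
    "of_real (walsh n c w) = N * (\<Sum>x\<in>bitvecs n. C x * e x)"
    "of_real (walsh n a w) = N * (\<Sum>x\<in>bitvecs n. A x * e x)"
    "of_real (walsh n b w) = N * (\<Sum>x\<in>bitvecs n. B x * e x)"
    "of_real (walsh n (\<lambda>x. a x + c x) w) = N * (\<Sum>x\<in>bitvecs n. A x * C x * e x)"
    "of_real (walsh n (\<lambda>x. b x + c x) w) = N * (\<Sum>x\<in>bitvecs n. B x * C x * e x)"
    "of_real (walsh n (\<lambda>x. a x + b x) w) = N * (\<Sum>x\<in>bitvecs n. A x * B x * e x)"
    unfolding of_real_walsh bit_sign_add N_def A_def B_def C_def e_def by (rule refl)+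
  have "2 * gen_walsh (n + 2) f (w @ [s, t]) = N * (\<Sum>v\<in>bitvecs (n + 2). ?g v)"
    unfolding gen_walsh_def mult.assoc[symmetric] N ..
  also have "(\<Sum>v\<in>bitvecs (n + 2). ?g v) =
      (\<Sum>x\<in>bitvecs n. C x * e x + \<sigma> * \<rho> * (A x * e x + \<i> * (A x * C x * e x))
        + \<tau> * \<rho> * (B x * e x + \<i> * (B x * C x * e x)) + \<sigma> * \<tau> * (A x * B x * e x))"
    unfolding sum_bitvecs_add_2 by (rule sum.cong[OF refl summand])
  also have "\<dots> = (\<Sum>x\<in>bitvecs n. C x * e x)
      + \<sigma> * \<rho> * ((\<Sum>x\<in>bitvecs n. A x * e x) + \<i> * (\<Sum>x\<in>bitvecs n. A x * C x * e x))
      + \<tau> * \<rho> * ((\<Sum>x\<in>bitvecs n. B x * e x) + \<i> * (\<Sum>x\<in>bitvecs n. B x * C x * e x))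
      + \<sigma> * \<tau> * (\<Sum>x\<in>bitvecs n. A x * B x * e x)"
    by (simp only: sum.distrib flip: sum_distrib_left)
  finally have "2 * gen_walsh (n + 2) f (w @ [s, t]) =
      of_real (walsh n c w)
      + \<sigma> * (of_real (walsh n a w) + \<i> * of_real (walsh n (\<lambda>x. a x + c x) w)) * \<rho>
      + \<tau> * (of_real (walsh n b w) + \<i> * of_real (walsh n (\<lambda>x. b x + c x) w)) * \<rho>
      + \<sigma> * \<tau> * of_real (walsh n (\<lambda>x. a x + b x) w)"
    unfolding walsh by (simp only: algebra_simps)
  then show ?thesis
    by (simp only: \<rho>_def \<sigma>_def \<tau>_def times_divide_eq_right mult_1_right)
qed

section \<open>The modulus\<close>

text \<open>
  When the squared modulus is expanded, the only term not governed by \<open>rel\<close> is a multiple of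
  \<open>(C + \<sigma> \<tau> D) (\<sigma> A + \<tau> B)\<close>. It vanishes because the data are signs: for signs, \<open>rel\<close> forces \<open>A B = - C D\<close>, so \<open>\<sigma> A = - \<tau> B\<close>
  if \<open>C = \<sigma> \<tau> D\<close>, and \<open>C = - \<sigma> \<tau> D\<close> otherwise.
\<close>

lemma cmod_sign_combination:
  fixes A B C D E F \<sigma> \<tau> :: real
  assumes signs: "\<bar>A\<bar> = 1" "\<bar>B\<bar> = 1" "\<bar>C\<bar> = 1" "\<bar>D\<bar> = 1" "\<bar>E\<bar> = 1" "\<bar>F\<bar> = 1"
      "\<bar>\<sigma>\<bar> = 1" "\<bar>\<tau>\<bar> = 1"
    and rel: "A * B + E * F = - 2 * D * C"
  shows "cmod (of_real C + of_real \<sigma> * (of_real A + \<i> * of_real E) / of_real (sqrt 2)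
      + of_real \<tau> * (of_real B + \<i> * of_real F) / of_real (sqrt 2)
      + of_real \<sigma> * of_real \<tau> * of_real D) = 2"
    (is "cmod ?Z = 2")
proof -
  define r where "r = 1 / sqrt 2"
  have r: "2 * r\<^sup>2 = 1"
    by (simp add: r_def power_divide)
  have squares: "A\<^sup>2 = 1" "B\<^sup>2 = 1" "C\<^sup>2 = 1" "D\<^sup>2 = 1" "E\<^sup>2 = 1" "F\<^sup>2 = 1" "\<sigma>\<^sup>2 = 1" "\<tau>\<^sup>2 = 1"
    using signs by (simp_all add: abs_square_eq_1)
  have cross: "(C + \<sigma> * \<tau> * D) * (\<sigma> * A + \<tau> * B) = 0"
  proof -
    \<comment> \<open>A sum of two signs equal to \<open>\<plusminus>2\<close> has both summands equal.\<close>
    have "A * B = - D * C"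
      using signs rel by (auto simp: abs_eq_iff')
    then show ?thesis
      using signs by (auto simp: abs_eq_iff')
  qed
  have "Re ?Z = C + \<sigma> * \<tau> * D + r * (\<sigma> * A + \<tau> * B)" "Im ?Z = r * (\<sigma> * E + \<tau> * F)"
    by (simp_all add: r_def field_simps)
  then have "(cmod ?Z)\<^sup>2 =
      (C + \<sigma> * \<tau> * D + r * (\<sigma> * A + \<tau> * B))\<^sup>2 + (r * (\<sigma> * E + \<tau> * F))\<^sup>2"
    by (simp only: cmod_power2)
  also have "\<dots> = 4 + \<sigma> * \<tau> * (2 * D * C + (A * B + E * F))
      + 2 * r * ((C + \<sigma> * \<tau> * D) * (\<sigma> * A + \<tau> * B))"
    using r squares by algebra
  also have "\<dots> = 2\<^sup>2"
    using rel cross by simp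
  finally show ?thesis
    by (rule power2_eq_imp_eq) simp_all
qed

theorem theorem7:
  fixes n :: nat
    and a b c :: "bit list \<Rightarrow> bit"
    and f :: "bit list \<Rightarrow> 8"
  assumes "even n" and "n > 0"
    and "bent n a" and "bent n b" and "bent n c"
    and "bent n (\<lambda>x. a x + c x)" and "bent n (\<lambda>x. b x + c x)" and "bent n (\<lambda>x. a x + b x)"
    and "\<And>x. x \<in> bitvecs n \<Longrightarrow>
           walsh n a x * walsh n b x
             + walsh n (\<lambda>t. a t + c t) x * walsh n (\<lambda>t. b t + c t) x
           = - 2 * walsh n (\<lambda>t. a t + b t) x * walsh n c x"
    and "\<And>x y z. x \<in> bitvecs n \<Longrightarrow>
           f (x @ [y, z]) =
             4 * of_bit (c x)
             + (4 * of_bit (a x) + 2 * of_bit (c x) + 1) * of_bit y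
             + (4 * of_bit (b x) + 2 * of_bit (c x) + 1) * of_bit z
             - 2 * of_bit y * of_bit z"
  shows "gbent (n + 2) f"
proof -
  have "cmod (gen_walsh (n + 2) f u) = 1" if u_in: "u \<in> bitvecs (n + 2)" for u
  proof -
    obtain w s t where u: "u = w @ [s, t]" and w: "w \<in> bitvecs n"
      using bitvecs_add_2_cases[OF u_in] .
    have "cmod (2 * gen_walsh (n + 2) f u) = 2"
      unfolding u
      by (subst gen_walsh_decomposition[OF assms(10) w], assumption, rule cmod_sign_combination)
        (use assms(3-9) w in \<open>simp_all add: bent_def abs_bit_sign\<close>)
    then show ?thesis
      by (simp add: norm_mult)
  qed
  then show ?thesis
    by (simp add: gbent_def)
qed

end
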